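(* Let $\mathcal{S}$ be a finite partially ordered set. For each linear extension $P$ of $\mathcal{S}$ let $$\mathfrak{h}_P(\mathbf{x})=\sum_{Q}\ \prod_{\alpha\in\mathcal{S}}x_{q_{P,Q}(\alpha)},$$ where the sum is over all linear extensions $Q$ of $\mathcal{S}$, $q_{P,Q}$ is the $P$-pedestal of $Q$, and $\mathbf{x}=(x_0,x_1,x_2,\dots)$ are commuting variables. Then $\mathfrak{h}_P(\mathbf{x})$ does not depend on $P$: for any two linear extensions $P,P'$ of $\mathcal{S}$ one has $\mathfrak{h}_P(\mathbf{x})=\mathfrak{h}_{P'}(\mathbf{x})$.
   Context: Let $\mathcal{S}$ be a finite partially ordered set with $n$ elements and order $\preccurlyeq$. A linear extension $P$ of $\mathcal{S}$ is a linear order $\preccurlyeq_P$ on $\mathcal{S}$ such that $\alpha\preccurlyeq\beta$ implies $\alpha\preccurlyeq_P\beta$. Given linear extensions $P,Q$ of $\mathcal{S}$, let $\alpha_1\prec_Q\alpha_2\prec_Q\dots\prec_Q\alpha_n$ be the list of all elements of $\mathcal{S}$ enumerated according to $\preccurlyeq_Q$. An element $\alpha_k$ (with $1\le k<n$) is called a $(P,Q)$-disagreement node if $\alpha_{k+1}\prec_P\alpha_k$. The $P$-pedestal of $Q$ is the function $q_{P,Q}\colon\mathcal{S}\to\mathbb{Z}_{\ge 0}$ defined by $$q_{P,Q}(\alpha_k)=\#\{\,l : l<k,\ \alpha_l\text{ is a }(P,Q)\text{-disagreement node}\,\}.$$ *)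

theory Defs
  imports "HOL-Library.Poly_Mapping"
begin

text \<open>Partial and linear orders on a carrier are reflexive relations, \<open>(a, b) \<in> r\<close> meaning \<open>a \<preceq> b\<close>.\<close>

definition linear_extensions :: "'a set \<Rightarrow> 'a rel \<Rightarrow> 'a rel set" where
  "linear_extensions S r = {P. linear_order_on S P \<and> r \<subseteq> P}"

definition strictly_below :: "'a rel \<Rightarrow> 'a \<Rightarrow> 'a \<Rightarrow> bool" where
  "strictly_below P a b \<longleftrightarrow> (a, b) \<in> P \<and> a \<noteq> b"

text \<open>The list \<open>\<alpha>\<^sub>1, \<dots>, \<alpha>\<^sub>n\<close> is indexed from 0: \<open>\<alpha>\<^sub>k\<close> is the list element with index \<open>k - 1\<close>.
  It is well defined by \<open>ex1_enumeration\<close> below.\<close>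

definition is_enumeration :: "'a set \<Rightarrow> 'a rel \<Rightarrow> 'a list \<Rightarrow> bool" where
  "is_enumeration S Q xs \<longleftrightarrow> set xs = S \<and> distinct xs \<and> sorted_wrt (strictly_below Q) xs"

definition enumeration :: "'a set \<Rightarrow> 'a rel \<Rightarrow> 'a list" where
  "enumeration S Q = (THE xs. is_enumeration S Q xs)"

definition disagreement_node :: "'a set \<Rightarrow> 'a rel \<Rightarrow> 'a rel \<Rightarrow> 'a \<Rightarrow> bool" where
  "disagreement_node S P Q a \<longleftrightarrow>
    (\<exists>k. Suc k < length (enumeration S Q) \<and> a = enumeration S Q ! k \<and>
         strictly_below P (enumeration S Q ! Suc k) (enumeration S Q ! k))"

definition position :: "'a set \<Rightarrow> 'a rel \<Rightarrow> 'a \<Rightarrow> nat" where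
  "position S Q a = (THE k. k < length (enumeration S Q) \<and> enumeration S Q ! k = a)"

definition pedestal :: "'a set \<Rightarrow> 'a rel \<Rightarrow> 'a rel \<Rightarrow> 'a \<Rightarrow> nat" where
  "pedestal S P Q a =
    card {l. l < position S Q a \<and> disagreement_node S P Q (enumeration S Q ! l)}"

text \<open>The polynomial ring over the integers in the variables \<open>x\<^sub>0, x\<^sub>1, \<dots>\<close> is the monoid ring of the
  finitely supported exponent vectors.\<close>

type_synonym int_mpoly = "(nat \<Rightarrow>\<^sub>0 nat) \<Rightarrow>\<^sub>0 int"

definition var :: "nat \<Rightarrow> int_mpoly" where
  "var i = Poly_Mapping.single (Poly_Mapping.single i 1) 1"

definition pedestal_polynomial :: "'a set \<Rightarrow> 'a rel \<Rightarrow> 'a rel \<Rightarrow> int_mpoly" where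
  "pedestal_polynomial S r P =
    (\<Sum>Q\<in>linear_extensions S r. \<Prod>a\<in>S. var (pedestal S P Q a))"

lemma finite_linear_extensions:
  assumes "finite S"
  shows "finite (linear_extensions S r)"
proof (rule finite_subset)
  show "linear_extensions S r \<subseteq> Pow (S \<times> S)"
    by (auto simp: linear_extensions_def order_on_defs)
  show "finite (Pow (S \<times> S))"
    using assms by simp
qed

lemma ex1_enumeration:
  assumes fin: "finite S" and lin: "linear_order_on S Q"
  shows "\<exists>!xs. is_enumeration S Q xs"
proof -
  define rk where "rk a = card {b \<in> S. strictly_below Q b a}" for a
  have tr: "trans Q" and an: "antisym Q" and tot: "total_on S Q"
    using lin by (auto simp: order_on_defs)
  have mono: "rk a < rk b" if "a \<in> S" "b \<in> S" "strictly_below Q a b" for a b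
    unfolding rk_def
  proof (rule psubset_card_mono)
    show "finite {c \<in> S. strictly_below Q c b}"
      using fin by simp
    have "{c \<in> S. strictly_below Q c a} \<subseteq> {c \<in> S. strictly_below Q c b}"
      using that tr an unfolding strictly_below_def by (auto dest: transD antisymD)
    moreover have "a \<in> {c \<in> S. strictly_below Q c b}" "a \<notin> {c \<in> S. strictly_below Q c a}"
      using that by (auto simp: strictly_below_def)
    ultimately show "{c \<in> S. strictly_below Q c a} \<subset> {c \<in> S. strictly_below Q c b}"
      by blast
  qed
  have cmp: "strictly_below Q a b \<or> strictly_below Q b a" if "a \<in> S" "b \<in> S" "a \<noteq> b" for a b
    using tot that by (auto simp: total_on_def strictly_below_def)
  have inj: "inj_on rk S"
    by (rule inj_onI) (metis cmp mono less_irrefl)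
  have iff: "strictly_below Q a b \<longleftrightarrow> rk a < rk b" if "a \<in> S" "b \<in> S" for a b
    using that by (metis cmp mono less_asym less_irrefl)
  have enum_iff: "is_enumeration S Q xs \<longleftrightarrow> set xs = S \<and> sorted_wrt (<) (map rk xs)" for xs
  proof -
    have "distinct xs" if "sorted_wrt (<) (map rk xs)"
      using that by (simp add: strict_sorted_iff distinct_map)
    moreover have "sorted_wrt (strictly_below Q) xs \<longleftrightarrow> sorted_wrt (<) (map rk xs)" if "set xs = S"
      unfolding sorted_wrt_map by (rule iffI; erule sorted_wrt_mono_rel[rotated]) (use that iff in auto)
    ultimately show ?thesis
      by (auto simp: is_enumeration_def)
  qed
  obtain ys where ys: "set ys = S" "distinct ys"
    using finite_distinct_list[OF fin] by blast
  show ?thesis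
  proof
    show "is_enumeration S Q (sort_key rk ys)"
      unfolding enum_iff strict_sorted_iff using ys inj by (simp add: distinct_map)
  next
    fix xs assume "is_enumeration S Q xs"
    then have xs: "set xs = S" "sorted_wrt (<) (map rk xs)"
      by (auto simp: enum_iff)
    have "map rk xs = map rk (sort_key rk ys)"
      by (rule strict_sorted_equal) (use xs ys inj in \<open>auto simp: strict_sorted_iff distinct_map\<close>)
    then show "xs = sort_key rk ys"
      using xs ys inj by (auto intro: map_inj_on)
  qed
qed

end

theory Submission
  imports Defs "HOL-Library.Multiset" "HOL-Library.FuncSet"
begin

text \<open>
  A linear extension \<open>Q\<close> enters its summand only through its descent set, the set of the indices of
  the \<open>(P, Q)\<close>-disagreement nodes. So it suffices that the number of \<open>Q\<close> with a given descent set is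
  independent of \<open>P\<close>, and by induction on \<open>D\<close> that the number of \<open>Q\<close> with descent set contained in
  \<open>D\<close> is. The latter are in bijection with the order-preserving maps \<open>f\<close> on the poset which take
  every value \<open>j\<close> as often as \<open>k \<mapsto> #{l \<in> D. l < k}\<close> does on \<open>{0, \<dots>, n - 1}\<close>, a condition in
  which \<open>P\<close> does not occur: \<open>Q\<close> is recovered from \<open>f\<close> by ordering the elements by \<open>f\<close> and breaking
  ties by \<open>P\<close>. This is Stanley's theory of \<open>P\<close>-partitions for a natural labelling.
\<close>

section \<open>Enumerations and positions in a linear order\<close>

lemma is_enumeration_enumeration:
  assumes "finite S" "linear_order_on S Q"
  shows "is_enumeration S Q (enumeration S Q)"
  unfolding enumeration_def by (rule theI') (rule ex1_enumeration[OF assms])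

lemma enumeration_props:
  assumes "finite S" "linear_order_on S Q"
  shows "set (enumeration S Q) = S" "distinct (enumeration S Q)"
    "sorted_wrt (strictly_below Q) (enumeration S Q)" "length (enumeration S Q) = card S"
  using is_enumeration_enumeration[OF assms] distinct_card[of "enumeration S Q"]
  by (simp_all add: is_enumeration_def)

lemma position_enumeration:
  assumes "finite S" "linear_order_on S Q" "k < card S"
  shows "position S Q (enumeration S Q ! k) = k"
  unfolding position_def
  by (rule the_equality) (use enumeration_props[OF assms(1,2)] assms(3) in \<open>auto simp: nth_eq_iff_index_eq\<close>)

lemma enumeration_position:
  assumes "finite S" "linear_order_on S Q" "a \<in> S"
  shows "position S Q a < card S" "enumeration S Q ! position S Q a = a"
proof -
  obtain k where "k < card S" "enumeration S Q ! k = a"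
    using enumeration_props[OF assms(1,2)] assms(3) by (metis in_set_conv_nth)
  then show "position S Q a < card S" "enumeration S Q ! position S Q a = a"
    using position_enumeration[OF assms(1,2)] by auto
qed

lemma bij_betw_position:
  assumes "finite S" "linear_order_on S Q"
  shows "bij_betw (position S Q) S {..<card S}"
proof (rule bij_betw_byWitness[where f' = "\<lambda>k. enumeration S Q ! k"])
  have "enumeration S Q ! k \<in> S" if "k < card S" for k
    using enumeration_props[OF assms] nth_mem[of k "enumeration S Q"] that by simp
  then show "(\<lambda>k. enumeration S Q ! k) ` {..<card S} \<subseteq> S"
    by auto
qed (use assms enumeration_position position_enumeration in auto)

text \<open>Turns comparisons in \<open>Q\<close> into comparisons of indices, to which the monotone
  \<open>level D\<close> can be applied.\<close>

lemma le_iff_position_le: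
  assumes "finite S" "linear_order_on S Q" "a \<in> S" "b \<in> S"
  shows "(a, b) \<in> Q \<longleftrightarrow> position S Q a \<le> position S Q b"
proof -
  let ?xs = "enumeration S Q"
  have lt: "strictly_below Q x y" if "x \<in> S" "y \<in> S" "position S Q x < position S Q y" for x y
    using enumeration_position[OF assms(1,2)] enumeration_props[OF assms(1,2)] that
    by (metis sorted_wrt_nth_less)
  have "refl_on S Q" "antisym Q"
    using assms(2) by (auto simp: order_on_defs)
  show ?thesis
  proof (cases "position S Q a" "position S Q b" rule: linorder_cases)
    case less
    then show ?thesis using lt assms by (auto simp: strictly_below_def)
  next
    case equal
    then have "a = b" using enumeration_position(2)[OF assms(1,2)] assms by metis
    then show ?thesis using \<open>refl_on S Q\<close> assms(3) by (auto simp: refl_on_def)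
  next
    case greater
    then show ?thesis using lt[of b a] assms \<open>antisym Q\<close>
      by (auto simp: strictly_below_def dest: antisymD)
  qed
qed

section \<open>Descent sets and the pedestal\<close>

definition descents :: "'a set \<Rightarrow> 'a rel \<Rightarrow> 'a rel \<Rightarrow> nat set" where
  "descents S P Q =
    {k. Suc k < card S \<and> strictly_below P (enumeration S Q ! Suc k) (enumeration S Q ! k)}"

text \<open>For \<open>D\<close> the descent set this is the pedestal as a function of the index. An
  arbitrary \<open>D\<close> is allowed because the count below runs over sets that merely contain
  the descent set.\<close>

definition level :: "nat set \<Rightarrow> nat \<Rightarrow> nat" where
  "level D k = card (D \<inter> {..<k})"

lemma mono_level: "mono (level D)"
  unfolding level_def by (intro monoI card_mono) auto

lemma level_Suc_less_iff: "level D k < level D (Suc k) \<longleftrightarrow> k \<in> D"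
  by (cases "k \<in> D") (auto simp: level_def lessThan_Suc Int_insert_right)

text \<open>The enumeration is distinct, so the index hidden in the existential of
  \<open>disagreement_node\<close> can only be \<open>l\<close>.\<close>

lemma disagreement_node_nth_iff:
  assumes "finite S" "linear_order_on S Q" "l < card S"
  shows "disagreement_node S P Q (enumeration S Q ! l) \<longleftrightarrow> l \<in> descents S P Q"
  using enumeration_props[OF assms(1,2)] assms(3)
  by (auto simp: disagreement_node_def descents_def nth_eq_iff_index_eq)

lemma pedestal_eq_level:
  assumes "finite S" "linear_order_on S Q" "a \<in> S"
  shows "pedestal S P Q a = level (descents S P Q) (position S Q a)"
  unfolding pedestal_def level_def
  by (rule arg_cong[where f = card])
    (use enumeration_position(1)[OF assms] disagreement_node_nth_iff[OF assms(1,2)] in auto)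

lemma prod_pedestal:
  assumes "finite S" "linear_order_on S Q"
  shows "(\<Prod>a\<in>S. var (pedestal S P Q a)) = (\<Prod>k<card S. var (level (descents S P Q) k))"
  using pedestal_eq_level[OF assms] prod.reindex_bij_betw[OF bij_betw_position[OF assms]]
  by simp

section \<open>The bijection with order-preserving maps\<close>

definition refined_order :: "'a set \<Rightarrow> 'a rel \<Rightarrow> ('a \<Rightarrow> nat) \<Rightarrow> 'a rel" where
  "refined_order S P f = {(a, b) \<in> S \<times> S. f a < f b \<or> f a = f b \<and> (a, b) \<in> P}"

lemma linear_order_on_refined_order:
  assumes "linear_order_on S P"
  shows "linear_order_on S (refined_order S P f)"
proof -
  have "refl_on S P" "trans P" "antisym P" "total_on S P"
    using assms by (auto simp: order_on_defs)
  have "refl_on S (refined_order S P f)"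
    using \<open>refl_on S P\<close> by (auto simp: refl_on_def refined_order_def)
  moreover have "trans (refined_order S P f)"
    by (rule transI) (use \<open>trans P\<close> in \<open>auto simp: refined_order_def dest: transD\<close>)
  moreover have "antisym (refined_order S P f)"
    by (rule antisymI) (use \<open>antisym P\<close> in \<open>auto simp: refined_order_def dest: antisymD\<close>)
  moreover have "total_on S (refined_order S P f)"
    using \<open>total_on S P\<close> unfolding total_on_def refined_order_def by fastforce
  ultimately show ?thesis
    by (auto simp: order_on_defs refined_order_def)
qed

text \<open>By totality, a pair of \<open>R\<close> missing from \<open>Q\<close> is reversed in
  \<open>Q\<close>, hence in \<open>R\<close>, against antisymmetry. So one inclusion will suffice
  to recover \<open>Q\<close> from its map.\<close>

lemma linear_order_on_subset_eq:
  assumes "linear_order_on S Q" "linear_order_on S R" "Q \<subseteq> R"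
  shows "Q = R"
proof
  show "R \<subseteq> Q"
  proof (rule subrelI)
    fix a b assume ab: "(a, b) \<in> R"
    then have "a \<in> S" "b \<in> S"
      using assms(2) by (auto simp: order_on_defs)
    moreover have "(a, b) \<in> Q" if "(b, a) \<in> Q"
      using that ab assms by (auto simp: order_on_defs dest: antisymD)
    ultimately show "(a, b) \<in> Q"
      using assms(1) by (cases "a = b") (auto simp: order_on_defs total_on_def refl_on_def)
  qed
qed fact

text \<open>The multiset equation prescribes how often each value is taken. Extensionality
  identifies maps that agree on \<open>S\<close>, so that they can be counted.\<close>

definition order_preserving_with_content :: "'a set \<Rightarrow> 'a rel \<Rightarrow> nat set \<Rightarrow> ('a \<Rightarrow> nat) set" where
  "order_preserving_with_content S r D =
    {f \<in> extensional S. (\<forall>(a, b)\<in>r. f a \<le> f b) \<and>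
      image_mset f (mset_set S) = image_mset (level D) (mset_set {..<card S})}"

text \<open>On a run of indices where \<open>level D\<close> is constant there is no descent, so
  \<open>P\<close> ascends along the run and breaking ties by \<open>P\<close> reproduces
  \<open>Q\<close>.\<close>

lemma refined_order_level_position:
  assumes fin: "finite S" and P: "linear_order_on S P" and Q: "linear_order_on S Q"
    and sub: "descents S P Q \<subseteq> D"
  shows "refined_order S P (\<lambda>a\<in>S. level D (position S Q a)) = Q"
proof (rule linear_order_on_subset_eq[symmetric])
  let ?xs = "enumeration S Q"
  note P' = P[unfolded order_on_defs]
  have ascend: "(?xs ! i, ?xs ! j) \<in> P" if "i \<le> j" "j < card S" "level D i = level D j" for i j
    using that
  proof (induction rule: dec_induct)
    case base
    then show ?case
      using P' enumeration_props[OF fin Q] by (metis nth_mem refl_onD)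
  next
    case (step k)
    \<comment> \<open>Monotonicity squeezes the intermediate value between the two equal
      ends.\<close>
    have eq: "level D i = level D k" "level D k = level D (Suc k)"
      using step.hyps step.prems monoD[OF mono_level, of i k D] monoD[OF mono_level, of k "Suc k" D]
      by auto
    then have "k \<notin> descents S P Q"
      using sub level_Suc_less_iff[of D k] by auto
    moreover have "?xs ! k \<in> S" "?xs ! Suc k \<in> S" "?xs ! k \<noteq> ?xs ! Suc k"
      using enumeration_props[OF fin Q] step.prems nth_mem[of k ?xs] nth_mem[of "Suc k" ?xs]
      by (simp_all add: nth_eq_iff_index_eq)
    ultimately have "(?xs ! k, ?xs ! Suc k) \<in> P"
      using P' step.prems by (auto simp: descents_def strictly_below_def total_on_def)
    then show ?case
      using P' step.IH step.prems eq by (auto dest: transD)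
  qed
  show "Q \<subseteq> refined_order S P (\<lambda>a\<in>S. level D (position S Q a))"
  proof (rule subrelI)
    fix a b assume ab: "(a, b) \<in> Q"
    then have S: "a \<in> S" "b \<in> S"
      using Q by (auto simp: order_on_defs)
    then have le: "position S Q a \<le> position S Q b"
      using le_iff_position_le[OF fin Q] ab by simp
    then have "level D (position S Q a) \<le> level D (position S Q b)"
      by (rule monoD[OF mono_level])
    moreover have "(a, b) \<in> P" if "level D (position S Q a) = level D (position S Q b)"
      using ascend[OF le _ that] enumeration_position[OF fin Q] S by simp
    ultimately show "(a, b) \<in> refined_order S P (\<lambda>a\<in>S. level D (position S Q a))"
      using S by (auto simp: refined_order_def)
  qed
qed (use Q linear_order_on_refined_order[OF P] in auto)

lemma level_position_order_preserving:
  assumes fin: "finite S" and Q: "linear_order_on S Q" "r \<subseteq> Q"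
  shows "(\<lambda>a\<in>S. level D (position S Q a)) \<in> order_preserving_with_content S r D"
proof -
  have "level D (position S Q a) \<le> level D (position S Q b)" "a \<in> S" "b \<in> S" if "(a, b) \<in> r" for a b
  proof -
    show S: "a \<in> S" "b \<in> S"
      using that Q by (auto simp: order_on_defs)
    show "level D (position S Q a) \<le> level D (position S Q b)"
      using that Q S le_iff_position_le[OF fin Q(1)] by (intro monoD[OF mono_level]) auto
  qed
  moreover have "image_mset (\<lambda>a\<in>S. level D (position S Q a)) (mset_set S)
      = image_mset (level D) (image_mset (position S Q) (mset_set S))"
    using fin by (auto simp: multiset.map_comp intro!: image_mset_cong)
  moreover have "image_mset (position S Q) (mset_set S) = mset_set {..<card S}"
    using bij_betw_position[OF fin Q(1)] by (simp add: bij_betw_def image_mset_mset_set)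
  ultimately show ?thesis
    by (auto simp: order_preserving_with_content_def)
qed

text \<open>Read along the enumeration of \<open>Q\<close>, the values of \<open>f\<close> form a
  sorted list with the same multiset as the sorted list of the \<open>level D k\<close>, so the two
  lists coincide.\<close>

lemma level_position_refined_order:
  assumes fin: "finite S" and P: "linear_order_on S P"
    and f: "f \<in> order_preserving_with_content S r D"
  defines "Q \<equiv> refined_order S P f"
  shows "(\<lambda>a\<in>S. level D (position S Q a)) = f" "descents S P Q \<subseteq> D"
proof -
  let ?xs = "enumeration S Q"
  have Q: "linear_order_on S Q"
    unfolding Q_def by (rule linear_order_on_refined_order[OF P])
  note xs = enumeration_props[OF fin Q]
  have "sorted_wrt (\<lambda>a b. f a \<le> f b) ?xs"
    by (rule sorted_wrt_mono_rel[OF _ xs(3)])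
      (auto simp: strictly_below_def Q_def refined_order_def)
  then have "sorted (map f ?xs)"
    by (simp add: sorted_map)
  moreover have "sorted (map (level D) [0..<card S])"
    by (simp add: sorted_map sorted_wrt_iff_nth_less monoD[OF mono_level])
  moreover have "mset (map f ?xs) = mset (map (level D) [0..<card S])"
    using f xs mset_set_set[OF xs(2)]
    by (auto simp: order_preserving_with_content_def atLeast0LessThan)
  ultimately have "map f ?xs = map (level D) [0..<card S]"
    by (metis properties_for_sort)
  then have f_nth: "f (?xs ! k) = level D k" if "k < card S" for k
    using that xs(4) by (metis add_0 diff_zero length_upt nth_map nth_upt)
  show "(\<lambda>a\<in>S. level D (position S Q a)) = f"
  proof (rule extensionalityI[where A = S])
    show "f \<in> extensional S"
      using f by (simp add: order_preserving_with_content_def)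
  qed (use f_nth enumeration_position[OF fin Q] in force)+
  show "descents S P Q \<subseteq> D"
  proof
    fix k assume "k \<in> descents S P Q"
    then have k: "Suc k < card S" "(?xs ! Suc k, ?xs ! k) \<in> P" "?xs ! Suc k \<noteq> ?xs ! k"
      by (auto simp: descents_def strictly_below_def)
    have "strictly_below Q (?xs ! k) (?xs ! Suc k)"
      using sorted_wrt_nth_less[OF xs(3), of k "Suc k"] k xs(4) by simp
    \<comment> \<open>In a tie \<open>Q\<close> would follow \<open>P\<close>, and the two elements
      would be related both ways in \<open>P\<close>.\<close>
    then have "f (?xs ! k) < f (?xs ! Suc k)"
      using k P by (auto simp: strictly_below_def Q_def refined_order_def order_on_defs dest: antisymD)
    then show "k \<in> D"
      using f_nth k by (simp add: level_Suc_less_iff)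
  qed
qed

lemma refined_order_linear_extension:
  assumes P: "P \<in> linear_extensions S r" and f: "\<And>a b. (a, b) \<in> r \<Longrightarrow> f a \<le> f b"
  shows "refined_order S P f \<in> linear_extensions S r"
proof -
  have "(a, b) \<in> refined_order S P f" if "(a, b) \<in> r" for a b
    using that P f[OF that]
    by (auto simp: refined_order_def linear_extensions_def order_on_defs le_less)
  then show ?thesis
    using P linear_order_on_refined_order by (auto simp: linear_extensions_def)
qed

lemma card_descents_subset:
  assumes fin: "finite S" and P: "P \<in> linear_extensions S r"
  shows "card {Q \<in> linear_extensions S r. descents S P Q \<subseteq> D}
    = card (order_preserving_with_content S r D)"
proof (rule bij_betw_same_card, rule bij_betw_byWitness[where f' = "refined_order S P"])
  let ?f = "\<lambda>Q. \<lambda>a\<in>S. level D (position S Q a)"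
  let ?LE = "{Q \<in> linear_extensions S r. descents S P Q \<subseteq> D}"
  have P': "linear_order_on S P"
    using P by (simp add: linear_extensions_def)
  show "\<forall>Q\<in>?LE. refined_order S P (?f Q) = Q"
    using refined_order_level_position[OF fin P'] by (simp add: linear_extensions_def)
  show "\<forall>f\<in>order_preserving_with_content S r D. ?f (refined_order S P f) = f"
    using level_position_refined_order(1)[OF fin P'] by blast
  show "?f ` ?LE \<subseteq> order_preserving_with_content S r D"
    using level_position_order_preserving[OF fin] by (auto simp: linear_extensions_def)
  show "refined_order S P ` order_preserving_with_content S r D \<subseteq> ?LE"
    using level_position_refined_order(2)[OF fin P'] refined_order_linear_extension[OF P]
    by (fastforce simp: order_preserving_with_content_def)
qed

section \<open>From inclusion to equality of descent sets\<close>

lemma card_fibre_eq_of_card_subset_eq: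
  assumes X: "finite X" and D: "finite D"
    and eq: "\<And>D. finite D \<Longrightarrow> card {x \<in> X. d x \<subseteq> D} = card {x \<in> X. d' x \<subseteq> D}"
  shows "card {x \<in> X. d x = D} = card {x \<in> X. d' x = D}"
  using D
proof (induction rule: finite_psubset_induct)
  case (psubset D)
  \<comment> \<open>Moebius inversion over subsets, done by induction: the terms for proper subsets
    agree by the induction hypothesis and cancel, leaving the term for \<open>D\<close>
    itself.\<close>
  have split: "card {x \<in> X. e x \<subseteq> D}
      = card {x \<in> X. e x = D} + (\<Sum>E | E \<subset> D. card {x \<in> X. e x = E})" for e
  proof -
    have fin: "finite {E. E \<subset> D}"
      by (rule finite_subset[of _ "Pow D"]) (use psubset.hyps in auto)
    have "{x \<in> X. e x \<subseteq> D} = (\<Union>E\<in>Pow D. {x \<in> X. e x = E})"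
      by auto
    also have "card \<dots> = (\<Sum>E\<in>Pow D. card {x \<in> X. e x = E})"
      by (rule card_UN_disjoint) (use X psubset.hyps in auto)
    also have "Pow D = insert D {E. E \<subset> D}"
      by auto
    finally show ?thesis
      using fin by simp
  qed
  have "(\<Sum>E | E \<subset> D. card {x \<in> X. d x = E}) = (\<Sum>E | E \<subset> D. card {x \<in> X. d' x = E})"
    using psubset.IH by (intro sum.cong) auto
  then show ?case
    using eq[OF psubset.hyps] split[of d] split[of d'] by simp
qed

lemma pedestal_polynomial_eq:
  assumes fin: "finite S"
  shows "pedestal_polynomial S r P
    = (\<Sum>D\<in>Pow {..<card S}. of_nat (card {Q \<in> linear_extensions S r. descents S P Q = D})
        * (\<Prod>k<card S. var (level D k)))"
proof -
  have "pedestal_polynomial S r P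
      = (\<Sum>Q\<in>linear_extensions S r. \<Prod>k<card S. var (level (descents S P Q) k))"
    unfolding pedestal_polynomial_def using prod_pedestal[OF fin]
    by (intro sum.cong) (auto simp: linear_extensions_def)
  also have "\<dots> = (\<Sum>D\<in>Pow {..<card S}. \<Sum>Q | Q \<in> linear_extensions S r \<and> descents S P Q = D.
      \<Prod>k<card S. var (level (descents S P Q) k))"
    by (rule sum.group[symmetric])
      (use finite_linear_extensions[OF fin] in \<open>auto simp: descents_def\<close>)
  \<comment> \<open>Within a group the product is constant, so the inner sum is the size of the
    group times that product.\<close>
  finally show ?thesis
    by simp
qed

theorem mainTheorem2:
  fixes S :: "'a set" and r P P' :: "'a rel"
  assumes "finite S" and "partial_order_on S r"
    and "P \<in> linear_extensions S r" and "P' \<in> linear_extensions S r"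
  shows "pedestal_polynomial S r P = pedestal_polynomial S r P'"
proof -
  \<comment> \<open>In the grouped form only these cardinalities involve the reference extension.
    For inclusion in \<open>D\<close>, both counts equal the number of the same order-preserving
    maps.\<close>
  have "card {Q \<in> linear_extensions S r. descents S P Q = D}
      = card {Q \<in> linear_extensions S r. descents S P' Q = D}" if "finite D" for D
    using finite_linear_extensions[OF assms(1)] that
    by (rule card_fibre_eq_of_card_subset_eq)
      (simp add: card_descents_subset[OF assms(1,3)] card_descents_subset[OF assms(1,4)])
  then show ?thesis
    unfolding pedestal_polynomial_eq[OF assms(1)]
    by (intro sum.cong) (auto dest: finite_subset)
qed

end
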